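(* Let $\delta>0$ and $1/3<\xi<1$, and for integers $k\ge1$, $n\ge 2$ let $$R(k,n,\xi,\delta)=\begin{cases} n^{-1/2}(n/k)^{3\xi-1}+(k/n)^{\delta}k^{1/2}+k/n & \text{for } 1/3<\xi<1/2,\\ k^{-\xi}+(k/n)^{\delta}k^{1/2}+k/n & \text{for } 1/2\le\xi<1.\end{cases}$$ Let $k^*=k^*(n)$ be a sequence of positive integers with $k^*\asymp n^{\alpha^*}$, where $$\alpha^*=\begin{cases}\left(\min\left(\frac{6\xi-1}{6\xi},\frac{6\xi+2\delta-3}{6\xi+2\delta-1}\right)\right)_+ & \text{for } 1/3<\xi<1/2,\\ \min\left(\frac{2\delta}{1+2(\delta+\xi)},\frac{1}{1+\xi}\right) & \text{for } 1/2\le\xi<1.\end{cases}$$ Then $$\min_{k\ge1}R(k,n,\xi,\delta)\asymp R(k^*,n,\xi,\delta)\asymp n^{\beta^*},$$ where for $1/3<\xi<1/2$ $$\beta^*=\begin{cases}-\delta & \text{for }\delta\le 3(1/2-\xi),\\ -\frac{3+2\delta-6\xi}{12\xi+4\delta-2} & \text{for }3(1/2-\xi)<\delta\le 1/2+3\xi,\\ -\frac{1}{6\xi} & \text{for }1/2+3\xi<\delta,\end{cases}$$ and $\beta^*=-\xi\alpha^*$ for $1/2\le\xi<1$.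
   Context: $(x)_+=\max(x,0)$. For two positive sequences $a_n,b_n$, $a_n\asymp b_n$ means $0<\liminf_{n\to\infty}a_n/b_n\le\limsup_{n\to\infty}a_n/b_n<\infty$. The minimum is over integers $k\ge1$, and $\xi,\delta$ are fixed as $n\to\infty$. *)

theory Defs
  imports Complex_Main "HOL-Library.Extended_Real"
begin

(* Limits inferior and superior are taken in the extended reals, where they always exist. *)
definition asymp_seq :: "(nat \<Rightarrow> real) \<Rightarrow> (nat \<Rightarrow> real) \<Rightarrow> bool" (infix "\<asymp>" 50) where
  "a \<asymp> b \<longleftrightarrow>
     0 < liminf (\<lambda>n. ereal (a n / b n)) \<and>
     liminf (\<lambda>n. ereal (a n / b n)) \<le> limsup (\<lambda>n. ereal (a n / b n)) \<and>
     limsup (\<lambda>n. ereal (a n / b n)) < \<infinity>"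

(* The formulas below are meant for 1/3 < xi < 1 and delta > 0, and R for k >= 1 and n >= 2;
   under these restrictions all bases of powr and all denominators are positive. *)
definition R :: "nat \<Rightarrow> nat \<Rightarrow> real \<Rightarrow> real \<Rightarrow> real" where
  "R k n \<xi> \<delta> =
     (if \<xi> < 1/2
      then real n powr (-1/2) * (real n / real k) powr (3 * \<xi> - 1)
           + (real k / real n) powr \<delta> * real k powr (1/2) + real k / real n
      else real k powr (-\<xi>)
           + (real k / real n) powr \<delta> * real k powr (1/2) + real k / real n)"

definition pos_part :: "real \<Rightarrow> real" where
  "pos_part x = max x 0"

definition alpha_star :: "real \<Rightarrow> real \<Rightarrow> real" where
  "alpha_star \<xi> \<delta> =
     (if \<xi> < 1/2
      then pos_part (min ((6 * \<xi> - 1) / (6 * \<xi>))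
                         ((6 * \<xi> + 2 * \<delta> - 3) / (6 * \<xi> + 2 * \<delta> - 1)))
      else min (2 * \<delta> / (1 + 2 * (\<delta> + \<xi>))) (1 / (1 + \<xi>)))"

definition beta_star :: "real \<Rightarrow> real \<Rightarrow> real" where
  "beta_star \<xi> \<delta> =
     (if \<xi> < 1/2
      then (if \<delta> \<le> 3 * (1/2 - \<xi>) then -\<delta>
            else if \<delta> \<le> 1/2 + 3 * \<xi>
                 then - ((3 + 2 * \<delta> - 6 * \<xi>) / (12 * \<xi> + 4 * \<delta> - 2))
            else - (1 / (6 * \<xi>)))
      else - \<xi> * alpha_star \<xi> \<delta>)"

end

(* Write k = n powr \<alpha>. Each of the three terms of R is a monomial in k and n, one decreasing in k
   and two increasing in k. At \<alpha> = alpha_star the larger increasing term is n powr beta_star, and the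
   decreasing term matches it unless \<alpha> = 0, where the constraint k \<ge> 1 is active. Hence for every
   k \<ge> 1 either an increasing term (k \<ge> n powr \<alpha>) or the decreasing term (k \<le> n powr \<alpha>) is at least
   n powr beta_star, while at k of order n powr \<alpha> all terms are O(n powr beta_star). *)

theory Submission
  imports Defs
begin

section \<open>Asymptotic equivalence as eventual two-sided bounds by real constants\<close>

lemma asymp_seqI:
  assumes "0 < c" and "\<forall>\<^sub>F n in sequentially. c \<le> a n / b n"
    and "\<forall>\<^sub>F n in sequentially. a n / b n \<le> C"
  shows "a \<asymp> b"
proof -
  have "ereal c \<le> liminf (\<lambda>n. ereal (a n / b n))"
    by (rule Liminf_bounded) (use assms(2) in simp)
  moreover have "limsup (\<lambda>n. ereal (a n / b n)) \<le> ereal C"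
    by (rule Limsup_bounded) (use assms(3) in simp)
  moreover have "liminf (\<lambda>n. ereal (a n / b n)) \<le> limsup (\<lambda>n. ereal (a n / b n))"
    by (rule Liminf_le_Limsup) simp
  moreover have "0 < ereal c" "ereal C < \<infinity>" using assms(1) by simp_all
  ultimately show ?thesis
    unfolding asymp_seq_def by (metis le_less_trans less_le_trans)
qed

text \<open>Density of the reals in the extended reals gives a real strictly between 0 and the limit
  inferior and one strictly above the limit superior. Strictness is what turns bounds on the limits
  into eventual bounds on the ratio.\<close>

lemma asymp_seqE:
  assumes "a \<asymp> b"
  obtains c C where "0 < c" and "\<forall>\<^sub>F n in sequentially. c \<le> a n / b n \<and> a n / b n \<le> C"
proof -
  obtain c where c: "0 < ereal c" "ereal c < liminf (\<lambda>n. ereal (a n / b n))"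
    using assms unfolding asymp_seq_def by (meson ereal_dense2)
  obtain C where C: "limsup (\<lambda>n. ereal (a n / b n)) < ereal C"
    using assms unfolding asymp_seq_def by (meson ereal_dense2)
  have "\<forall>\<^sub>F n in sequentially. ereal c < ereal (a n / b n)"
    using c(2) by (rule less_LiminfD)
  moreover have "\<forall>\<^sub>F n in sequentially. ereal (a n / b n) < ereal C"
    using C by (rule Limsup_lessD)
  ultimately have "\<forall>\<^sub>F n in sequentially. c \<le> a n / b n \<and> a n / b n \<le> C"
    by eventually_elim auto
  with c(1) show thesis by (auto intro: that)
qed

section \<open>The monomials of \<open>R\<close> and the balance of their exponents\<close>

definition decay_offset :: "real \<Rightarrow> real" where
  "decay_offset \<xi> = (if \<xi> < 1/2 then 3 * \<xi> - 3/2 else 0)"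

definition decay_rate :: "real \<Rightarrow> real" where
  "decay_rate \<xi> = (if \<xi> < 1/2 then 3 * \<xi> - 1 else \<xi>)"

lemma decay_rate_pos: "1/3 < \<xi> \<Longrightarrow> 0 < decay_rate \<xi>"
  by (simp add: decay_rate_def)

text \<open>Gives both regimes of \<open>\<xi>\<close> one shape, so that the case distinction is
  confined to the exponent computation.\<close>

lemma R_monomials:
  assumes "k \<ge> 1" "n \<ge> 1"
  shows "R k n \<xi> \<delta> = real n powr decay_offset \<xi> * real k powr (- decay_rate \<xi>)
           + real n powr (-\<delta>) * real k powr (\<delta> + 1/2) + real n powr (-1) * real k powr 1"
proof -
  have n: "real n > 0" and k: "real k > 0" using assms by auto
  have "real n powr (-1/2) * (real n / real k) powr (3 * \<xi> - 1)
      = real n powr (-1/2 + (3 * \<xi> - 1)) * real k powr (- (3 * \<xi> - 1))"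
    unfolding powr_add powr_minus_divide[of _ "3 * \<xi> - 1"] by (simp add: powr_divide)
  also have "-1/2 + (3 * \<xi> - 1) = 3 * \<xi> - 3/2" by simp
  finally have 1: "real n powr (-1/2) * (real n / real k) powr (3 * \<xi> - 1)
      = real n powr (3 * \<xi> - 3/2) * real k powr (- (3 * \<xi> - 1))" .
  have 2: "(real k / real n) powr \<delta> * real k powr (1/2)
      = real n powr (-\<delta>) * real k powr (\<delta> + 1/2)"
    unfolding powr_add powr_minus_divide[of _ \<delta>] by (simp add: powr_divide)
  have 3: "real k / real n = real n powr (-1) * real k powr 1"
    using n k by (simp add: powr_minus field_simps)
  \<comment> \<open>For \<open>\<xi> \<ge> 1/2\<close> the factor \<open>n powr 0\<close> must be 1,
    which needs \<open>n > 0\<close> because \<open>0 powr 0 = 0\<close>.\<close>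
  show ?thesis
    unfolding R_def decay_offset_def decay_rate_def 1 2 unfolding 3 using n by simp
qed

text \<open>With \<open>k = n powr \<alpha>\<close> each monomial has an exponent linear in
  \<open>\<alpha>\<close>. The line of the decreasing term crosses the two increasing lines at one
  point each; \<open>alpha_star\<close> is the smaller crossing point, truncated at 0, and
  \<open>beta_star\<close> is the height of the upper increasing line there.\<close>

lemma alpha_beta_balance:
  fixes \<xi> \<delta> :: real
  assumes "\<delta> > 0" "1/3 < \<xi>"
  defines "\<alpha> \<equiv> alpha_star \<xi> \<delta>" and "\<beta> \<equiv> beta_star \<xi> \<delta>"
  shows "\<alpha> \<ge> 0"
    and "\<beta> = max (-\<delta> + (\<delta> + 1/2) * \<alpha>) (-1 + \<alpha>)"
    and "decay_offset \<xi> - decay_rate \<xi> * \<alpha> \<le> \<beta>"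
    and "\<alpha> = 0 \<or> decay_offset \<xi> - decay_rate \<xi> * \<alpha> = \<beta>"
proof -
  have "\<alpha> \<ge> 0 \<and> \<beta> = max (-\<delta> + (\<delta> + 1/2) * \<alpha>) (-1 + \<alpha>)
      \<and> decay_offset \<xi> - decay_rate \<xi> * \<alpha> \<le> \<beta>
      \<and> (\<alpha> = 0 \<or> decay_offset \<xi> - decay_rate \<xi> * \<alpha> = \<beta>)"
  proof (cases "\<xi> < 1/2")
    case True
    \<comment> \<open>\<open>D / 2\<close> is \<open>decay_rate \<xi> + \<delta> + 1/2\<close>, the
      difference of slopes between the line of \<open>(k/n) powr \<delta> * k powr (1/2)\<close> and
      the decreasing one. These meet at \<open>1 - 2 / D\<close>; the line of \<open>k/n\<close>
      meets the decreasing one at \<open>1 - 1 / (6 * \<xi>)\<close>.\<close>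
    define D where "D = 6 * \<xi> + 2 * \<delta> - 1"
    have D: "D > 1" using assms(1,2) by (simp add: D_def)
    have \<alpha>1: "(6 * \<xi> - 1) / (6 * \<xi>) = 1 - 1 / (6 * \<xi>)"
      using assms(1,2) by (simp add: field_simps)
    have \<alpha>2: "(6 * \<xi> + 2 * \<delta> - 3) / (6 * \<xi> + 2 * \<delta> - 1) = 1 - 2 / D"
      using D by (simp add: D_def field_simps)
    have \<alpha>: "\<alpha> = max (min (1 - 1 / (6 * \<xi>)) (1 - 2 / D)) 0"
      using True unfolding \<alpha>_def alpha_star_def pos_part_def \<alpha>1 \<alpha>2 by simp
    have pos: "1 - 1 / (6 * \<xi>) > 0" using assms(1,2) by (simp add: field_simps)
    consider "\<delta> \<le> 3 * (1/2 - \<xi>)" | "3 * (1/2 - \<xi>) < \<delta>" "\<delta> \<le> 1/2 + 3 * \<xi>" | "1/2 + 3 * \<xi> < \<delta>"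
      by linarith
    then show ?thesis
    proof cases
      case 1
      then have "D \<le> 2" by (simp add: D_def)
      then have "1 - 2 / D \<le> 0" using D by (simp add: field_simps)
      then have "\<alpha> = 0" using \<alpha> by simp
      moreover have "\<beta> = -\<delta>" using True 1 by (simp add: \<beta>_def beta_star_def)
      \<comment> \<open>Here \<open>\<xi> > 1/3\<close> forces \<open>\<delta> < 1/2\<close>, so
        \<open>-\<delta>\<close> exceeds the exponent -1 of \<open>k/n\<close> at
        \<open>\<alpha> = 0\<close>.\<close>
      ultimately show ?thesis using True 1 assms(1,2) by (simp add: decay_offset_def)
    next
      case 2
      then have "D > 2" by (simp add: D_def)
      then have "1 - 2 / D > 0" using D by (simp add: field_simps)
      \<comment> \<open>This is equivalent to \<open>\<delta> \<le> 1/2 + 3 * \<xi>\<close>: at that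
        threshold the two crossing points coincide.\<close>
      moreover have "1 / (6 * \<xi>) \<le> 2 / D"
        using 2 D assms(1,2) by (simp add: D_def field_simps)
      ultimately have a: "\<alpha> = 1 - 2 / D" using \<alpha> by simp
      have "\<beta> = - ((3 + 2 * \<delta> - 6 * \<xi>) / (2 * D))"
        using True 2 by (simp add: \<beta>_def beta_star_def D_def algebra_simps)
      then have b: "\<beta> = -\<delta> + (\<delta> + 1/2) * \<alpha>"
        unfolding a using D by (simp add: field_simps) (simp add: D_def algebra_simps)
      have c: "decay_offset \<xi> - decay_rate \<xi> * \<alpha> = \<beta>"
        unfolding b a decay_offset_def decay_rate_def using True D
        by (simp add: field_simps) (simp add: D_def algebra_simps)
      have "\<beta> - (-1 + \<alpha>) = 1/2 - (\<delta> - 1/2) * (2 / D)"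
        unfolding b a by (simp add: algebra_simps)
      also have "\<dots> \<ge> 0" using D 2 by (simp add: field_simps) (simp add: D_def)
      finally show ?thesis using a b c \<open>1 - 2 / D > 0\<close> by simp
    next
      case 3
      then have "2 / D \<le> 1 / (6 * \<xi>)"
        using D assms(1,2) by (simp add: D_def field_simps)
      then have a: "\<alpha> = 1 - 1 / (6 * \<xi>)" using \<alpha> pos by simp
      have b: "\<beta> = -1 + \<alpha>" using True 3 assms(1,2) by (simp add: \<beta>_def beta_star_def a)
      have c: "decay_offset \<xi> - decay_rate \<xi> * \<alpha> = \<beta>"
        unfolding b a decay_offset_def decay_rate_def using True assms(1,2) by (simp add: field_simps)
      have "(-1 + \<alpha>) - (-\<delta> + (\<delta> + 1/2) * \<alpha>) = (\<delta> - 1/2) * (1 / (6 * \<xi>)) - 1/2"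
        unfolding a using assms(1,2) by (simp add: field_simps)
      also have "\<dots> \<ge> 0" using 3 assms(1,2) by (simp add: field_simps)
      finally show ?thesis using a b c pos by simp
    qed
  next
    case False
    define D where "D = 1 + 2 * (\<delta> + \<xi>)"
    have D: "D > 0" using assms(1,2) by (simp add: D_def)
    have \<alpha>: "\<alpha> = min (2 * \<delta> / D) (1 / (1 + \<xi>))"
      using False by (simp add: \<alpha>_def alpha_star_def D_def)
    have b: "\<beta> = - \<xi> * \<alpha>" using False by (simp add: \<alpha>_def \<beta>_def beta_star_def)
    have "\<alpha> \<ge> 0" using \<alpha> D assms(1,2) by simp
    \<comment> \<open>The decreasing line is now \<open>- \<xi> * \<alpha>\<close>, which is
      \<open>\<beta>\<close> itself. Each increasing line minus \<open>\<beta>\<close> is a positive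
      multiple of the distance from its crossing point, so the \<open>min\<close> in
      \<open>\<alpha>\<close> makes both differences nonpositive and one of them zero.\<close>
    have B: "-\<delta> + (\<delta> + 1/2) * \<alpha> - \<beta> = D / 2 * (\<alpha> - 2 * \<delta> / D)"
      unfolding b using D by (simp add: field_simps) (simp add: D_def algebra_simps)
    have C: "-1 + \<alpha> - \<beta> = (1 + \<xi>) * (\<alpha> - 1 / (1 + \<xi>))"
      unfolding b using assms(1,2) by (simp add: field_simps)
    have "\<alpha> - 2 * \<delta> / D \<le> 0" "\<alpha> - 1 / (1 + \<xi>) \<le> 0" using \<alpha> by auto
    then have "-\<delta> + (\<delta> + 1/2) * \<alpha> - \<beta> \<le> 0" "-1 + \<alpha> - \<beta> \<le> 0"
      unfolding B C using D assms(1,2) by (auto intro!: mult_nonneg_nonpos simp del: times_divide_eq_left)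
    moreover have "-\<delta> + (\<delta> + 1/2) * \<alpha> - \<beta> = 0 \<or> -1 + \<alpha> - \<beta> = 0"
      unfolding B C using \<alpha> by (auto simp: min_def)
    ultimately have "\<beta> = max (-\<delta> + (\<delta> + 1/2) * \<alpha>) (-1 + \<alpha>)" by linarith
    then show ?thesis
      using \<open>\<alpha> \<ge> 0\<close> b False by (simp add: decay_offset_def decay_rate_def)
  qed
  then show "\<alpha> \<ge> 0"
    and "\<beta> = max (-\<delta> + (\<delta> + 1/2) * \<alpha>) (-1 + \<alpha>)"
    and "decay_offset \<xi> - decay_rate \<xi> * \<alpha> \<le> \<beta>"
    and "\<alpha> = 0 \<or> decay_offset \<xi> - decay_rate \<xi> * \<alpha> = \<beta>"
    by blast+
qed

section \<open>Lower and upper bounds for \<open>R\<close> by multiples of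
  \<open>n powr beta_star\<close>\<close>

lemma R_lower_bound:
  assumes "\<delta> > 0" "1/3 < \<xi>" "k \<ge> 1" "n \<ge> 1"
  shows "real n powr beta_star \<xi> \<delta> \<le> R k n \<xi> \<delta>"
proof -
  define \<alpha> where "\<alpha> = alpha_star \<xi> \<delta>"
  define \<beta> where "\<beta> = beta_star \<xi> \<delta>"
  note bal = alpha_beta_balance[OF assms(1,2), folded \<alpha>_def \<beta>_def]
  have n: "real n > 0" and k: "real k > 0" using assms by auto
  have mono_pos: "real n powr p * real k powr q \<ge> 0" for p q by simp
  have K: "real n powr p * (real n powr \<alpha>) powr q = real n powr (p + q * \<alpha>)" for p q
    using n by (simp add: powr_powr powr_add mult.commute)
  have "real n powr \<beta> \<le> R k n \<xi> \<delta>"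
  proof (cases "real n powr \<alpha> \<le> real k")
    case True
    have up: "real n powr (p + q * \<alpha>) \<le> real n powr p * real k powr q" if "q \<ge> 0" for p q
      unfolding K[symmetric] using True that by (intro mult_left_mono powr_mono2) auto
    have "real n powr \<beta> \<le> real n powr (-\<delta>) * real k powr (\<delta> + 1/2) + real n powr (-1) * real k powr 1"
      using up[of "\<delta> + 1/2" "-\<delta>"] up[of 1 "-1"] assms(1) bal(2)
        mono_pos[of "-\<delta>" "\<delta> + 1/2"] mono_pos[of "-1" 1]
      by (simp only: max_def mult_1 split: if_splits) linarith+
    then show ?thesis
      unfolding R_monomials[OF assms(3,4)]
      using mono_pos[of "decay_offset \<xi>" "- decay_rate \<xi>"] by linarith
  next
    case False
    \<comment> \<open>If \<open>\<alpha>\<close> were 0, then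
      \<open>n powr \<alpha> = 1 \<le> k\<close>, against the case assumption.\<close>
    then have "\<alpha> \<noteq> 0" using assms n by auto
    then have "\<beta> = decay_offset \<xi> + (- decay_rate \<xi>) * \<alpha>" using bal(4) by simp
    then have "real n powr \<beta> = real n powr decay_offset \<xi> * (real n powr \<alpha>) powr (- decay_rate \<xi>)"
      by (simp only: K)
    also have "\<dots> \<le> real n powr decay_offset \<xi> * real k powr (- decay_rate \<xi>)"
      using False k decay_rate_pos[OF assms(2)] by (intro mult_left_mono powr_mono2') auto
    finally show ?thesis
      unfolding R_monomials[OF assms(3,4)]
      using mono_pos[of "-\<delta>" "\<delta> + 1/2"] mono_pos[of "-1" 1] by linarith
  qed
  then show ?thesis by (simp add: \<beta>_def)
qed

text \<open>Nonnegative exponents use the upper bound on \<open>x\<close>, negative ones the lower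
  bound; adding both constants gives one estimate for either sign.\<close>

lemma powr_le_of_two_sided_bound:
  fixes c C K x t :: real
  assumes "0 < c" "0 < K" "c * K \<le> x" "x \<le> C * K"
  shows "x powr t \<le> (c powr t + C powr t) * K powr t"
proof -
  have x: "x > 0" using assms by (smt (verit) mult_pos_pos)
  then have "C * K > 0" using assms by linarith
  then have C: "C > 0" using assms(2) by (simp add: zero_less_mult_iff)
  have "x powr t \<le> (c * K) powr t + (C * K) powr t"
  proof (cases "t \<ge> 0")
    case True
    then have "x powr t \<le> (C * K) powr t" using x assms by (intro powr_mono2) auto
    then show ?thesis by (smt (verit) powr_ge_zero)
  next
    case False
    then have "x powr t \<le> (c * K) powr t" using assms by (intro powr_mono2') auto
    then show ?thesis by (smt (verit) powr_ge_zero)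
  qed
  then show ?thesis using assms C by (simp add: powr_mult distrib_right)
qed

text \<open>\<open>M\<close> is chosen before \<open>k\<close> and \<open>n\<close>, so it is
  uniform in both. For \<open>k\<close> of order \<open>n powr alpha_star\<close> each monomial is
  at most a constant times \<open>n\<close> to its balanced exponent, and none of these exponents
  exceeds \<open>beta_star\<close>.\<close>

lemma R_upper_bound:
  fixes c C \<xi> \<delta> :: real
  assumes "\<delta> > 0" "1/3 < \<xi>" "0 < c"
  obtains M where "\<And>k n. \<lbrakk>k \<ge> 1; n \<ge> 1; c * real n powr alpha_star \<xi> \<delta> \<le> real k;
      real k \<le> C * real n powr alpha_star \<xi> \<delta>\<rbrakk> \<Longrightarrow> R k n \<xi> \<delta> \<le> M * real n powr beta_star \<xi> \<delta>"
proof
  define \<alpha> where "\<alpha> = alpha_star \<xi> \<delta>"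
  define \<beta> where "\<beta> = beta_star \<xi> \<delta>"
  note bal = alpha_beta_balance[OF assms(1,2), folded \<alpha>_def \<beta>_def]
  define m where "m t = c powr t + C powr t" for t
  fix k n :: nat
  assume k: "k \<ge> 1" and n: "n \<ge> 1" and ck: "c * real n powr alpha_star \<xi> \<delta> \<le> real k"
    and kC: "real k \<le> C * real n powr alpha_star \<xi> \<delta>"
  have n0: "real n > 0" using n by simp
  have *: "real n powr p * real k powr q \<le> m q * real n powr \<beta>" if "p + q * \<alpha> \<le> \<beta>" for p q
  proof -
    have "real n powr p * real k powr q \<le> real n powr p * (m q * (real n powr \<alpha>) powr q)"
      using powr_le_of_two_sided_bound[OF assms(3) _ ck kC, of q] n0
      by (intro mult_left_mono) (auto simp: m_def \<alpha>_def)
    also have "\<dots> = m q * real n powr (p + q * \<alpha>)"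
      using n0 by (simp add: powr_powr powr_add mult.commute mult.left_commute)
    also have "\<dots> \<le> m q * real n powr \<beta>"
      using that n by (intro mult_left_mono powr_mono) (auto simp: m_def)
    finally show ?thesis .
  qed
  show "R k n \<xi> \<delta> \<le> (m (- decay_rate \<xi>) + m (\<delta> + 1/2) + m 1) * real n powr beta_star \<xi> \<delta>"
    unfolding R_monomials[OF k n] distrib_right \<beta>_def[symmetric]
    using bal(2,3) by (intro add_mono *) auto
qed

section \<open>Existence of a minimiser and the asymptotics of the minimum\<close>

lemma R_attains_min:
  assumes "n \<ge> 1"
  shows "\<exists>k\<ge>1. \<forall>j\<ge>1. R k n \<xi> \<delta> \<le> R j n \<xi> \<delta>"
proof -
  \<comment> \<open>Beyond \<open>N\<close> the term \<open>k/n\<close> alone is at least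
    \<open>R 1 n \<xi> \<delta>\<close>, so a minimiser over \<open>{1..N}\<close> is global. The
    \<open>max\<close> keeps 1 in the range.\<close>
  define N where "N = max 1 (nat \<lceil>real n * R 1 n \<xi> \<delta>\<rceil>)"
  obtain k where k: "k \<in> {1..N}" "\<forall>j\<in>{1..N}. R k n \<xi> \<delta> \<le> R j n \<xi> \<delta>"
    using arg_min_if_finite[of "{1..N}" "\<lambda>k. R k n \<xi> \<delta>"] arg_min_least[of "{1..N}" _ "\<lambda>k. R k n \<xi> \<delta>"]
    by (metis N_def atLeastatMost_empty_iff finite_atLeastAtMost max.cobounded1)
  have "R k n \<xi> \<delta> \<le> R j n \<xi> \<delta>" if "j \<ge> 1" for j
  proof (cases "j \<le> N")
    case True
    then show ?thesis using k that by simp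
  next
    case False
    have "R k n \<xi> \<delta> \<le> R 1 n \<xi> \<delta>" using k by (simp add: N_def)
    also have "R 1 n \<xi> \<delta> \<le> real j / real n"
    proof -
      have "real n * R 1 n \<xi> \<delta> \<le> real j" using False unfolding N_def by linarith
      then show ?thesis using assms by (simp add: field_simps)
    qed
    also have "real j / real n \<le> R j n \<xi> \<delta>" by (simp add: R_def)
    finally show ?thesis .
  qed
  then show ?thesis using k(1) by auto
qed

text \<open>The first conjunct shows that the infimum in the second is an attained minimum for
  \<open>n \<ge> 2\<close>.\<close>

theorem lemma1:
  fixes \<xi> \<delta> :: real and kstar :: "nat \<Rightarrow> nat"
  assumes "\<delta> > 0" and "1/3 < \<xi>" and "\<xi> < 1"
    and "\<And>n. n \<ge> 2 \<Longrightarrow> kstar n \<ge> 1"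
    and "(\<lambda>n. real (kstar n)) \<asymp> (\<lambda>n. real n powr alpha_star \<xi> \<delta>)"
  shows "(\<forall>n\<ge>2. \<exists>k\<ge>1. \<forall>j\<ge>1. R k n \<xi> \<delta> \<le> R j n \<xi> \<delta>)
    \<and> (\<lambda>n. INF k\<in>{1..}. R k n \<xi> \<delta>) \<asymp> (\<lambda>n. R (kstar n) n \<xi> \<delta>)
    \<and> (\<lambda>n. R (kstar n) n \<xi> \<delta>) \<asymp> (\<lambda>n. real n powr beta_star \<xi> \<delta>)"
proof (intro conjI)
  let ?b = "\<lambda>n. real n powr beta_star \<xi> \<delta>"
  show "\<forall>n\<ge>2. \<exists>k\<ge>1. \<forall>j\<ge>1. R k n \<xi> \<delta> \<le> R j n \<xi> \<delta>"
    using R_attains_min by simp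
  obtain c C where c: "0 < c" and kstar: "\<forall>\<^sub>F n in sequentially.
      c \<le> real (kstar n) / real n powr alpha_star \<xi> \<delta> \<and> real (kstar n) / real n powr alpha_star \<xi> \<delta> \<le> C"
    using asymp_seqE[OF assms(5)] by blast
  obtain M where M: "\<And>k n. \<lbrakk>k \<ge> 1; n \<ge> 1; c * real n powr alpha_star \<xi> \<delta> \<le> real k;
      real k \<le> C * real n powr alpha_star \<xi> \<delta>\<rbrakk> \<Longrightarrow> R k n \<xi> \<delta> \<le> M * ?b n"
    using R_upper_bound[OF assms(1,2) c] by blast
  have lower: "?b n \<le> R k n \<xi> \<delta>" if "k \<ge> 1" "n \<ge> 1" for k n
    using R_lower_bound[OF assms(1,2) that] .
  have ev: "\<forall>\<^sub>F n in sequentially. n \<ge> 2 \<and> R (kstar n) n \<xi> \<delta> \<le> M * ?b n"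
    using kstar eventually_ge_at_top[of 2]
  proof eventually_elim
    case (elim n)
    then have "real n powr alpha_star \<xi> \<delta> > 0" by simp
    then show ?case using elim assms(4)[of n] by (intro conjI M) (auto simp: field_simps)
  qed
  then have ratio: "\<forall>\<^sub>F n in sequentially. 1 \<le> R (kstar n) n \<xi> \<delta> / ?b n \<and> R (kstar n) n \<xi> \<delta> / ?b n \<le> M"
  proof eventually_elim
    case (elim n)
    then have "?b n > 0" by simp
    then show ?case using elim lower[of "kstar n" n] assms(4)[of n] by (simp add: field_simps)
  qed
  then show "(\<lambda>n. R (kstar n) n \<xi> \<delta>) \<asymp> ?b"
    by (intro asymp_seqI[of 1 _ _ M]) (auto elim: eventually_mono)
  \<comment> \<open>Both ratio bounds hold together at some \<open>n\<close>, hence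
    \<open>1 \<le> M\<close>; this makes \<open>1 / M\<close> a legitimate positive lower
    constant.\<close>
  have "M \<ge> 1"
  proof -
    have "\<exists>n. 1 \<le> R (kstar n) n \<xi> \<delta> / ?b n \<and> R (kstar n) n \<xi> \<delta> / ?b n \<le> M"
      using ratio eventually_happens by fastforce
    then show ?thesis by force
  qed
  \<comment> \<open>The infimum lies between \<open>?b n\<close> and
    \<open>R (kstar n) n \<xi> \<delta>\<close>, and the latter is at most
    \<open>M * ?b n\<close>.\<close>
  have "\<forall>\<^sub>F n in sequentially. 1 / M \<le> (INF k\<in>{1..}. R k n \<xi> \<delta>) / R (kstar n) n \<xi> \<delta>
      \<and> (INF k\<in>{1..}. R k n \<xi> \<delta>) / R (kstar n) n \<xi> \<delta> \<le> 1"
    using ev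
  proof eventually_elim
    case (elim n)
    have k: "kstar n \<ge> 1" using elim assms(4) by simp
    have "?b n > 0" using elim by simp
    then have pos: "R (kstar n) n \<xi> \<delta> > 0" using lower[OF k, of n] elim by linarith
    have "?b n \<le> (INF k\<in>{1..}. R k n \<xi> \<delta>)"
      using lower elim by (intro cINF_greatest) auto
    then have "R (kstar n) n \<xi> \<delta> \<le> M * (INF k\<in>{1..}. R k n \<xi> \<delta>)"
      using elim \<open>M \<ge> 1\<close> by (smt (verit) mult_left_mono)
    moreover have "(INF k\<in>{1..}. R k n \<xi> \<delta>) \<le> R (kstar n) n \<xi> \<delta>"
      using lower elim k by (intro cINF_lower bdd_belowI2[of _ "?b n"]) auto
    ultimately show ?case using pos \<open>M \<ge> 1\<close> by (simp add: field_simps)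
  qed
  then show "(\<lambda>n. INF k\<in>{1..}. R k n \<xi> \<delta>) \<asymp> (\<lambda>n. R (kstar n) n \<xi> \<delta>)"
    using \<open>M \<ge> 1\<close> by (intro asymp_seqI[of "1 / M" _ _ 1]) (auto elim: eventually_mono)
qed

end
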